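(* Let $\mathcal{V}$ be a vector space of $\mathbb{R}$-valued random variables and let $\rho$ be a risk measure on $\mathcal{V}$. Then $\rho$ is Lipschitz continuous with constant $1$ with respect to the seminorm $\|\cdot\|:=\rho(|\cdot|)$ on $L:=\{Y\in\mathcal{V}:\rho(|Y|)<\infty\}$, that is, $|\rho(Y_2)-\rho(Y_1)|\le\|Y_2-Y_1\|$ for all $Y_1,Y_2\in L$.
   Context: Random variables live on a probability space $(\Omega,\mathcal{F},P)$. The vector space $\mathcal{V}$ contains the constants and is closed under $Y\mapsto|Y|$. A risk measure on $\mathcal{V}$ is a function $\rho:\mathcal{V}\to\mathbb{R}\cup\{+\infty\}$ with $\rho(0)<\infty$ satisfying: (Monotonicity) $\rho(Y_1)\le\rho(Y_2)$ whenever $Y_1\le Y_2$ almost surely; (Positive homogeneity) $\rho(\lambda Y)=\lambda\rho(Y)$ whenever $\lambda>0$; (Convexity) $\rho((1-\lambda)Y_0+\lambda Y_1)\le(1-\lambda)\rho(Y_0)+\lambda\rho(Y_1)$ for $0\le\lambda\le1$; (Translation equivariance) $\rho(Y+c)=\rho(Y)+c$ for $c\in\mathbb{R}$. *)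

theory Defs
  imports "HOL-Probability.Probability" "HOL-Library.Function_Algebras"
begin

definition scale_fun :: "real \<Rightarrow> ('a \<Rightarrow> real) \<Rightarrow> 'a \<Rightarrow> real" (infixr "*\<^sub>F" 75)
  where "c *\<^sub>F Y = (\<lambda>\<omega>. c * Y \<omega>)"

interpretation fun_space: vector_space "scale_fun :: real \<Rightarrow> ('a \<Rightarrow> real) \<Rightarrow> 'a \<Rightarrow> real"
  by unfold_locales (simp_all add: scale_fun_def fun_eq_iff algebra_simps)

(* Random variables are represented by functions rather than by classes modulo a.s. equality;
   monotonicity forces rho to agree on functions that are equal almost surely. *)

locale random_variable_space = prob_space M
  for M :: "'a measure" +
  fixes V :: "('a \<Rightarrow> real) set"
  assumes measurable: "V \<subseteq> borel_measurable M"
    and subspace: "fun_space.subspace V"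
    and const: "\<And>c. (\<lambda>_. c) \<in> V"
    and abs: "\<And>Y. Y \<in> V \<Longrightarrow> (\<lambda>\<omega>. \<bar>Y \<omega>\<bar>) \<in> V"

(* Only the values of rho on V matter: outside V, rho is arbitrary. For l = 0 or l = 1 the
   convention 0 * \<infinity> = 0 of ereal turns convexity into a trivial equality. *)

locale risk_measure = random_variable_space M V
  for M :: "'a measure" and V :: "('a \<Rightarrow> real) set" +
  fixes \<rho> :: "('a \<Rightarrow> real) \<Rightarrow> ereal"
  assumes not_MInf: "\<And>Y. Y \<in> V \<Longrightarrow> \<rho> Y \<noteq> -\<infinity>"
    and zero_finite: "\<rho> (\<lambda>_. 0) < \<infinity>"
    and monotone: "\<And>Y\<^sub>1 Y\<^sub>2. Y\<^sub>1 \<in> V \<Longrightarrow> Y\<^sub>2 \<in> V \<Longrightarrow>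
      AE \<omega> in M. Y\<^sub>1 \<omega> \<le> Y\<^sub>2 \<omega> \<Longrightarrow> \<rho> Y\<^sub>1 \<le> \<rho> Y\<^sub>2"
    and pos_homogeneous: "\<And>Y l. Y \<in> V \<Longrightarrow> 0 < l \<Longrightarrow> \<rho> (l *\<^sub>F Y) = ereal l * \<rho> Y"
    and convex: "\<And>Y\<^sub>0 Y\<^sub>1 l. Y\<^sub>0 \<in> V \<Longrightarrow> Y\<^sub>1 \<in> V \<Longrightarrow> 0 \<le> l \<Longrightarrow> l \<le> 1 \<Longrightarrow>
      \<rho> ((1 - l) *\<^sub>F Y\<^sub>0 + l *\<^sub>F Y\<^sub>1) \<le> ereal (1 - l) * \<rho> Y\<^sub>0 + ereal l * \<rho> Y\<^sub>1"
    and translation: "\<And>Y c. Y \<in> V \<Longrightarrow> \<rho> (\<lambda>\<omega>. Y \<omega> + c) = \<rho> Y + ereal c"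

definition risk_norm :: "(('a \<Rightarrow> real) \<Rightarrow> ereal) \<Rightarrow> ('a \<Rightarrow> real) \<Rightarrow> ereal"
  where "risk_norm \<rho> Y = \<rho> (\<lambda>\<omega>. \<bar>Y \<omega>\<bar>)"

definition finite_norm_space ::
    "('a \<Rightarrow> real) set \<Rightarrow> (('a \<Rightarrow> real) \<Rightarrow> ereal) \<Rightarrow> ('a \<Rightarrow> real) set"
  where "finite_norm_space V \<rho> = {Y \<in> V. \<rho> (\<lambda>\<omega>. \<bar>Y \<omega>\<bar>) < \<infinity>}"

(* The clauses 0 \<le> N Y and N Y < \<infinity> say that N is real-valued on L. *)

definition seminorm_on :: "('a \<Rightarrow> real) set \<Rightarrow> (('a \<Rightarrow> real) \<Rightarrow> ereal) \<Rightarrow> bool"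
  where "seminorm_on L N \<longleftrightarrow> fun_space.subspace L \<and>
    (\<forall>Y\<in>L. 0 \<le> N Y \<and> N Y < \<infinity>) \<and>
    (\<forall>Y\<in>L. \<forall>c. N (c *\<^sub>F Y) = ereal \<bar>c\<bar> * N Y) \<and>
    (\<forall>Y\<^sub>1\<in>L. \<forall>Y\<^sub>2\<in>L. N (Y\<^sub>1 + Y\<^sub>2) \<le> N Y\<^sub>1 + N Y\<^sub>2)"

end

theory Submission
  imports Defs
begin

text \<open>
  Convexity at the midpoint together with positive homogeneity makes \<open>\<rho>\<close> subadditive,
  \<open>\<rho> (X + Y) = 2 * \<rho> (X / 2 + Y / 2) \<le> \<rho> X + \<rho> Y\<close>, and positive homogeneity together with
  \<open>\<rho> 0 < \<infinity>\<close> forces \<open>\<rho> 0 = 0\<close>. Hence \<open>\<rho>\<close> is sublinear and monotone, and monotonicity transports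
  sublinearity through the pointwise relations \<open>\<bar>X + Y\<bar> \<le> \<bar>X\<bar> + \<bar>Y\<bar>\<close>, \<open>0 \<le> \<bar>Y\<bar>\<close> and
  \<open>\<bar>c Y\<bar> = \<bar>c\<bar> \<bar>Y\<bar>\<close>, which gives the seminorm. The Lipschitz estimate is the usual one for a
  sublinear functional dominated by a seminorm: writing \<open>Y = X + (Y - X)\<close> yields
  \<open>\<rho> Y \<le> \<rho> X + \<rho> (Y - X) \<le> \<rho> X + \<rho> \<bar>Y - X\<bar>\<close>, and the roles of \<open>X\<close> and \<open>Y\<close> can be exchanged.
\<close>

context risk_measure
begin

lemma add_in_V: "X \<in> V \<Longrightarrow> Y \<in> V \<Longrightarrow> X + Y \<in> V"
  using subspace by (rule fun_space.subspace_add)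

lemma diff_in_V: "X \<in> V \<Longrightarrow> Y \<in> V \<Longrightarrow> X - Y \<in> V"
  using subspace by (rule fun_space.subspace_diff)

lemma scale_in_V: "Y \<in> V \<Longrightarrow> c *\<^sub>F Y \<in> V"
  using subspace by (rule fun_space.subspace_scale)

text \<open>Since \<open>2 * 0 = 0\<close>, the value at \<open>0\<close> is a finite solution of \<open>r = 2 * r\<close>.\<close>

lemma risk_zero: "\<rho> (\<lambda>_. 0) = 0"
proof -
  have "2 *\<^sub>F (\<lambda>_. 0) = (\<lambda>_::'a. 0)"
    by (simp add: scale_fun_def)
  then have "\<rho> (\<lambda>_. 0) = ereal 2 * \<rho> (\<lambda>_. 0)"
    using pos_homogeneous[of "\<lambda>_. 0" 2] const by simp
  then show ?thesis
    using zero_finite not_MInf[OF const, of 0] by (cases "\<rho> (\<lambda>_. 0)") auto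
qed

lemma risk_subadditive:
  assumes X: "X \<in> V" and Y: "Y \<in> V"
  shows "\<rho> (X + Y) \<le> \<rho> X + \<rho> Y"
proof -
  let ?m = "(1 - 1/2) *\<^sub>F X + (1/2) *\<^sub>F Y"
  have m: "?m \<in> V"
    by (intro add_in_V scale_in_V X Y)
  have "X + Y = 2 *\<^sub>F ?m"
    by (simp add: scale_fun_def fun_eq_iff algebra_simps)
  then have "\<rho> (X + Y) = ereal 2 * \<rho> ?m"
    using pos_homogeneous[OF m, of 2] by simp
  also have "\<dots> \<le> ereal 2 * (ereal (1 - 1/2) * \<rho> X + ereal (1/2) * \<rho> Y)"
    using convex[OF X Y, of "1/2"] by (intro ereal_mult_left_mono) auto
  also have "\<dots> = \<rho> X + \<rho> Y"
    using not_MInf[OF X] not_MInf[OF Y]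
    by (cases "\<rho> X"; cases "\<rho> Y") (auto simp: algebra_simps)
  finally show ?thesis .
qed

lemma risk_le_risk_norm: "Y \<in> V \<Longrightarrow> \<rho> Y \<le> risk_norm \<rho> Y"
  unfolding risk_norm_def by (intro monotone abs) auto

lemma risk_norm_nonneg:
  assumes "Y \<in> V"
  shows "0 \<le> risk_norm \<rho> Y"
  using monotone[OF const abs[OF assms], of 0] by (simp add: risk_norm_def risk_zero)

lemma risk_norm_triangle:
  assumes X: "X \<in> V" and Y: "Y \<in> V"
  shows "risk_norm \<rho> (X + Y) \<le> risk_norm \<rho> X + risk_norm \<rho> Y"
proof -
  have "risk_norm \<rho> (X + Y) \<le> \<rho> ((\<lambda>\<omega>. \<bar>X \<omega>\<bar>) + (\<lambda>\<omega>. \<bar>Y \<omega>\<bar>))"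
    unfolding risk_norm_def
    by (intro monotone abs add_in_V X Y) (auto intro: abs_triangle_ineq)
  also have "\<dots> \<le> risk_norm \<rho> X + risk_norm \<rho> Y"
    unfolding risk_norm_def by (intro risk_subadditive abs X Y)
  finally show ?thesis .
qed

lemma risk_norm_scale:
  assumes Y: "Y \<in> V"
  shows "risk_norm \<rho> (c *\<^sub>F Y) = ereal \<bar>c\<bar> * risk_norm \<rho> Y"
proof (cases "c = 0")
  case True
  \<comment> \<open>The right-hand side vanishes even if the norm of \<open>Y\<close> is infinite,
    because \<open>0 * \<infinity> = 0\<close> in \<open>ereal\<close>.\<close>
  then show ?thesis
    by (simp add: risk_norm_def scale_fun_def risk_zero flip: zero_ereal_def)
next
  case False
  have "(\<lambda>\<omega>. \<bar>(c *\<^sub>F Y) \<omega>\<bar>) = \<bar>c\<bar> *\<^sub>F (\<lambda>\<omega>. \<bar>Y \<omega>\<bar>)"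
    by (simp add: scale_fun_def abs_mult)
  then show ?thesis
    using pos_homogeneous[OF abs[OF Y], of "\<bar>c\<bar>"] False by (simp add: risk_norm_def)
qed

lemma finite_norm_space_iff:
  "Y \<in> finite_norm_space V \<rho> \<longleftrightarrow> Y \<in> V \<and> risk_norm \<rho> Y < \<infinity>"
  by (simp add: finite_norm_space_def risk_norm_def)

lemma subspace_finite_norm_space: "fun_space.subspace (finite_norm_space V \<rho>)"
proof (rule fun_space.subspaceI)
  show "0 \<in> finite_norm_space V \<rho>"
    using const[of 0]
    by (simp add: finite_norm_space_iff risk_norm_def risk_zero zero_fun_def)
next
  fix X Y
  assume "X \<in> finite_norm_space V \<rho>" "Y \<in> finite_norm_space V \<rho>"
  then show "X + Y \<in> finite_norm_space V \<rho>"
    using risk_norm_triangle[of X Y] add_in_V[of X Y]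
    by (auto simp: finite_norm_space_iff intro: le_less_trans)
next
  fix c Y
  assume "Y \<in> finite_norm_space V \<rho>"
  then show "c *\<^sub>F Y \<in> finite_norm_space V \<rho>"
    using risk_norm_nonneg[of Y]
    by (cases "risk_norm \<rho> Y") (auto simp: finite_norm_space_iff risk_norm_scale scale_in_V)
qed

lemma seminorm_risk_norm: "seminorm_on (finite_norm_space V \<rho>) (risk_norm \<rho>)"
  unfolding seminorm_on_def
  using subspace_finite_norm_space
  by (auto simp: finite_norm_space_iff risk_norm_nonneg risk_norm_scale risk_norm_triangle)

lemma risk_finite:
  assumes "Y \<in> finite_norm_space V \<rho>"
  shows "\<bar>\<rho> Y\<bar> \<noteq> \<infinity>"
  using assms risk_le_risk_norm[of Y] not_MInf[of Y]
  by (auto simp: finite_norm_space_iff)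

text \<open>
  This half of the Lipschitz estimate is stated as a sum because it then holds on all of \<open>V\<close>,
  infinite values included.
\<close>

lemma risk_le_add_risk_norm_diff:
  assumes X: "X \<in> V" and Y: "Y \<in> V"
  shows "\<rho> Y \<le> \<rho> X + risk_norm \<rho> (Y - X)"
proof -
  have "\<rho> Y = \<rho> (X + (Y - X))"
    by simp
  also have "\<dots> \<le> \<rho> X + \<rho> (Y - X)"
    by (intro risk_subadditive diff_in_V X Y)
  also have "\<dots> \<le> \<rho> X + risk_norm \<rho> (Y - X)"
    by (intro add_left_mono risk_le_risk_norm diff_in_V X Y)
  finally show ?thesis .
qed

lemma risk_norm_minus_commute: "risk_norm \<rho> (X - Y) = risk_norm \<rho> (Y - X)"
  by (simp add: risk_norm_def abs_minus_commute)

lemma risk_Lipschitz: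
  assumes X: "X \<in> finite_norm_space V \<rho>" and Y: "Y \<in> finite_norm_space V \<rho>"
  shows "\<bar>\<rho> Y - \<rho> X\<bar> \<le> risk_norm \<rho> (Y - X)"
proof -
  have V: "X \<in> V" "Y \<in> V"
    using X Y by (simp_all add: finite_norm_space_iff)
  show ?thesis
    using risk_le_add_risk_norm_diff[OF V] risk_le_add_risk_norm_diff[OF V(2,1)]
      risk_finite[OF X] risk_finite[OF Y]
    unfolding risk_norm_minus_commute[of X Y]
    by (cases "\<rho> X"; cases "\<rho> Y"; cases "risk_norm \<rho> (Y - X)") auto
qed

end

theorem proposition6:
  fixes M :: "'a measure" and V :: "('a \<Rightarrow> real) set" and \<rho> :: "('a \<Rightarrow> real) \<Rightarrow> ereal"
  assumes "risk_measure M V \<rho>"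
  defines "L \<equiv> finite_norm_space V \<rho>"
  shows "seminorm_on L (risk_norm \<rho>) \<and>
    (\<forall>Y\<in>L. \<bar>\<rho> Y\<bar> \<noteq> \<infinity>) \<and>
    (\<forall>Y\<^sub>1\<in>L. \<forall>Y\<^sub>2\<in>L. \<bar>\<rho> Y\<^sub>2 - \<rho> Y\<^sub>1\<bar> \<le> risk_norm \<rho> (Y\<^sub>2 - Y\<^sub>1))"
proof -
  interpret risk_measure M V \<rho>
    by fact
  show ?thesis
    unfolding L_def by (intro conjI ballI seminorm_risk_norm risk_finite risk_Lipschitz)
qed

end
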